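(* Let $\alpha_0,\alpha_1\in\mathbb{R}$ and let $\mathcal{F}$ be the set of all continuously differentiable functions $f:[0,1]\to\mathbb{R}$ with $\int_0^1 x^kf(x)\,dx=\alpha_k$ for $k=0,1$. Then the optimal range interval of $\mathcal{F}$ is $[A,B]$ with $A=B=12\alpha_1-6\alpha_0$, and the optimal length of $\mathcal{F}$ is $L=0$.
   Context: For a set $\mathcal{F}$ of continuously differentiable functions on $[0,1]$: (1) The optimal range interval of $\mathcal{F}$ is the largest interval $[A,B]$ (with $A\le B$ real, $A=B$ allowed) such that $[A,B]\subseteq \mathrm{Range}(f')$ for every $f\in\mathcal{F}$; that is, $[A,B]$ has this property and contains every other such interval with this property. (2) The optimal length of $\mathcal{F}$ is the largest number $L\ge 0$ such that for every $f\in\mathcal{F}$ there is an interval $[a,b]$ (possibly depending on $f$) with $b-a=L$ and $[a,b]\subseteq \mathrm{Range}(f')$. Here $\mathrm{Range}(f')=f'([0,1])$. *)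

theory Defs
  imports "HOL-Analysis.Analysis"
begin

text \<open>
  A function on \<open>[0,1]\<close> is represented by a total function on the reals whose values outside
  \<open>[0,1]\<close> are irrelevant: derivatives are taken within \<open>{0..1}\<close>, hence one-sided at the endpoints.
\<close>

definition unit_deriv :: "(real \<Rightarrow> real) \<Rightarrow> real \<Rightarrow> real" where
  "unit_deriv f x = vector_derivative f (at x within {0..1})"

definition C1_unit :: "(real \<Rightarrow> real) \<Rightarrow> bool" where
  "C1_unit f \<longleftrightarrow> f differentiable_on {0..1} \<and> continuous_on {0..1} (unit_deriv f)"

definition deriv_range :: "(real \<Rightarrow> real) \<Rightarrow> real set" where
  "deriv_range f = unit_deriv f ` {0..1}"

definition common_range_interval :: "(real \<Rightarrow> real) set \<Rightarrow> real \<Rightarrow> real \<Rightarrow> bool" where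
  "common_range_interval F A B \<longleftrightarrow> A \<le> B \<and> (\<forall>f\<in>F. {A..B} \<subseteq> deriv_range f)"

definition optimal_range_interval :: "(real \<Rightarrow> real) set \<Rightarrow> real \<Rightarrow> real \<Rightarrow> bool" where
  "optimal_range_interval F A B \<longleftrightarrow>
     common_range_interval F A B \<and>
     (\<forall>A' B'. common_range_interval F A' B' \<longrightarrow> {A'..B'} \<subseteq> {A..B})"

definition common_range_length :: "(real \<Rightarrow> real) set \<Rightarrow> real \<Rightarrow> bool" where
  "common_range_length F L \<longleftrightarrow>
     L \<ge> 0 \<and> (\<forall>f\<in>F. \<exists>a b. b - a = L \<and> {a..b} \<subseteq> deriv_range f)"

definition optimal_length :: "(real \<Rightarrow> real) set \<Rightarrow> real \<Rightarrow> bool" where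
  "optimal_length F L \<longleftrightarrow>
     common_range_length F L \<and> (\<forall>L'. common_range_length F L' \<longrightarrow> L' \<le> L)"

definition moment_class :: "real \<Rightarrow> real \<Rightarrow> (real \<Rightarrow> real) set" where
  "moment_class \<alpha>0 \<alpha>1 =
     {f. C1_unit f \<and>
         integral {0..1} (\<lambda>x. x ^ 0 * f x) = \<alpha>0 \<and>
         integral {0..1} (\<lambda>x. x ^ 1 * f x) = \<alpha>1}"

end

theory Submission
  imports Defs
begin

text \<open>
  Integration by parts against the weight \<open>6 x (1 - x)\<close>, which vanishes at both endpoints and has
  total mass 1, exhibits \<open>12 \<alpha>1 - 6 \<alpha>0\<close> as a weighted mean of \<open>f'\<close>, hence as a value of \<open>f'\<close>.
  The affine member of the class has constant derivative, so nothing larger is possible.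
\<close>

text \<open>A continuous \<open>g\<close> without a root keeps one sign on \<open>{a..b}\<close>, so
  its integral against a nonnegative continuous weight that is somewhere positive cannot vanish. The
  weight may have zeros, as \<open>6 x (1 - x)\<close> does at the endpoints.\<close>

lemma weighted_integral_zero_imp_root:
  fixes w g :: "real \<Rightarrow> real"
  assumes ab: "a < b"
    and w: "continuous_on {a..b} w" "\<And>x. x \<in> {a..b} \<Longrightarrow> w x \<ge> 0"
    and c: "c \<in> {a..b}" "w c > 0"
    and g: "continuous_on {a..b} g"
    and int: "integral {a..b} (\<lambda>x. w x * g x) = 0"
  shows "\<exists>x\<in>{a..b}. g x = 0"
proof (rule ccontr)
  assume nz: "\<not> (\<exists>x\<in>{a..b}. g x = 0)"
  have same_sign: "g c * g x \<ge> 0" if x: "x \<in> {a..b}" for x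
  proof (rule ccontr)
    assume "\<not> g c * g x \<ge> 0"
    then have "g c \<le> 0 \<and> 0 \<le> g x \<or> g x \<le> 0 \<and> 0 \<le> g c"
      by (auto simp: not_le mult_less_0_iff)
    moreover have "connected (g ` {a..b})"
      using g by (intro connected_continuous_image) auto
    ultimately have "0 \<in> g ` {a..b}"
      using x c(1) by (meson connectedD_interval imageI)
    then show False
      using nz by force
  qed
  \<comment> \<open>The constant factor \<open>g c\<close> makes the integrand nonnegative whichever
    sign \<open>g\<close> has; at \<open>c\<close> its value is
    \<open>w c * (g c)^2 > 0\<close>.\<close>
  have "integral {a..b} (\<lambda>x. g c * (w x * g x)) = 0"
    using int by simp
  moreover have "continuous_on (cbox a b) (\<lambda>x. g c * (w x * g x))"
    using w g by (auto intro!: continuous_intros)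
  moreover have "0 \<le> g c * (w x * g x)" if "x \<in> cbox a b" for x
    using mult_nonneg_nonneg[OF w(2) same_sign, of x x] that by (simp add: ac_simps)
  ultimately have "\<forall>x\<in>cbox a b. g c * (w x * g x) = 0"
    using integral_cbox_eq_0_iff[of a b "\<lambda>x. g c * (w x * g x)"] ab by auto
  then show False
    using c nz by auto
qed

lemma moment_slope_in_deriv_range:
  assumes "f \<in> moment_class \<alpha>0 \<alpha>1"
  shows "12 * \<alpha>1 - 6 * \<alpha>0 \<in> deriv_range f"
proof -
  define m where "m = 12 * \<alpha>1 - 6 * \<alpha>0"
  define w :: "real \<Rightarrow> real" where "w = (\<lambda>x. 6 * x * (1 - x))"
  have diff: "f differentiable_on {0..1}" and cont': "continuous_on {0..1} (unit_deriv f)"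
    and I0: "integral {0..1} f = \<alpha>0" and I1: "integral {0..1} (\<lambda>x. x * f x) = \<alpha>1"
    using assms by (auto simp: moment_class_def C1_unit_def)
  have cont: "continuous_on {0..1} f"
    using diff by (rule differentiable_imp_continuous_on)
  have deriv: "(f has_real_derivative unit_deriv f x) (at x within {0..1})" if "x \<in> {0..1}" for x
    using diff that unfolding unit_deriv_def differentiable_on_def
    by (simp add: has_real_derivative_iff_has_vector_derivative
        flip: vector_derivative_works)
  \<comment> \<open>The integrand is the derivative of \<open>w x * f x\<close>, since
    \<open>w' x = 6 - 12 * x\<close>; the right-hand side is 0 because
    \<open>w 0 = w 1 = 0\<close>.\<close>
  have F: "((\<lambda>x. (6 - 12 * x) * f x + w x * unit_deriv f x) has_integral w 1 * f 1 - w 0 * f 0) {0..1}"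
    unfolding w_def
    by (rule fundamental_theorem_of_calculus)
       (auto intro!: derivative_eq_intros deriv simp: algebra_simps
          simp flip: has_real_derivative_iff_has_vector_derivative)
  have G: "((\<lambda>x. (6 - 12 * x) * f x) has_integral 6 * \<alpha>0 - 12 * \<alpha>1) {0..1}"
  proof -
    have "(f has_integral \<alpha>0) {0..1}" "((\<lambda>x. x * f x) has_integral \<alpha>1) {0..1}"
      using I0 I1 cont by (auto intro!: integrable_integral integrable_continuous_real continuous_intros
          simp: has_integral_iff)
    then have "((\<lambda>x. 6 * f x - 12 * (x * f x)) has_integral 6 * \<alpha>0 - 12 * \<alpha>1) {0..1}"
      by (intro has_integral_diff has_integral_mult_right)
    then show ?thesis
      by (simp add: algebra_simps)
  qed
  have W: "(w has_integral 1) {0..1}"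
  proof -
    \<comment> \<open>The antiderivative of \<open>w\<close> used here is
      \<open>3 * x^2 - 2 * x^3\<close>.\<close>
    have "(w has_integral (3 * 1^2 - 2 * 1^3) - (3 * 0^2 - 2 * 0^3)) {0..1}"
      unfolding w_def
      by (rule fundamental_theorem_of_calculus)
         (auto intro!: derivative_eq_intros simp: algebra_simps power2_eq_square
            simp flip: has_real_derivative_iff_has_vector_derivative)
    then show ?thesis by simp
  qed
  have "((\<lambda>x. w x * unit_deriv f x) has_integral m) {0..1}"
    using has_integral_diff[OF F G] by (simp add: w_def m_def)
  \<comment> \<open>As \<open>w\<close> has mass 1, the integral of \<open>w x * m\<close> is also
    \<open>m\<close>, and the difference integrates to 0.\<close>
  from has_integral_diff[OF this has_integral_mult_left[OF W, of m]]
  have "integral {0..1} (\<lambda>x. w x * (unit_deriv f x - m)) = 0"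
    by (simp add: algebra_simps integral_unique)
  then have "\<exists>x\<in>{0..1}. unit_deriv f x - m = 0"
    by (intro weighted_integral_zero_imp_root[where w = w and c = "1/2"])
       (auto simp: w_def intro!: continuous_intros cont')
  then show ?thesis
    by (force simp: deriv_range_def m_def)
qed

lemma unit_deriv_affine:
  assumes "x \<in> {0..1}"
  shows "unit_deriv (\<lambda>x. m * x + c) x = m"
  unfolding unit_deriv_def using assms
  by (intro vector_derivative_within_cbox[of 0 1, simplified])
     (auto intro!: derivative_eq_intros simp flip: has_real_derivative_iff_has_vector_derivative)

text \<open>The moments of \<open>m * x + c\<close> are \<open>m / 2 + c\<close> and
  \<open>m / 3 + c / 2\<close>. Equating them with \<open>\<alpha>0\<close> and
  \<open>\<alpha>1\<close> forces \<open>c = \<alpha>0 - m / 2\<close> and then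
  \<open>m / 12 = \<alpha>1 - \<alpha>0 / 2\<close>.\<close>

lemma affine_in_moment_class:
  fixes \<alpha>0 \<alpha>1 :: real
  defines "m \<equiv> 12 * \<alpha>1 - 6 * \<alpha>0"
  shows "(\<lambda>x. m * x + (\<alpha>0 - m / 2)) \<in> moment_class \<alpha>0 \<alpha>1"
proof -
  define c where "c = \<alpha>0 - m / 2"
  have "((\<lambda>x. m * x + c) has_integral (m * 1^2 / 2 + c * 1) - (m * 0^2 / 2 + c * 0)) {0..1}"
    by (rule fundamental_theorem_of_calculus)
       (auto intro!: derivative_eq_intros
          simp flip: has_real_derivative_iff_has_vector_derivative)
  then have I0: "integral {0..1} (\<lambda>x. m * x + c) = \<alpha>0"
    by (simp add: integral_unique c_def)
  have "((\<lambda>x. x * (m * x + c)) has_integral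
      (m * 1^3 / 3 + c * 1^2 / 2) - (m * 0^3 / 3 + c * 0^2 / 2)) {0..1}"
    by (rule fundamental_theorem_of_calculus)
       (auto intro!: derivative_eq_intros simp: algebra_simps power2_eq_square
          simp flip: has_real_derivative_iff_has_vector_derivative)
  then have "integral {0..1} (\<lambda>x. x * (m * x + c)) = m / 3 + c / 2"
    by (simp add: integral_unique)
  also have "m / 3 + c / 2 = \<alpha>1"
    by (simp add: c_def m_def field_simps)
  finally have I1: "integral {0..1} (\<lambda>x. x * (m * x + c)) = \<alpha>1" .
  have "continuous_on {0..1} (unit_deriv (\<lambda>x. m * x + c))"
    by (rule continuous_on_eq[OF continuous_on_const]) (simp add: unit_deriv_affine)
  then have "C1_unit (\<lambda>x. m * x + c)"
    unfolding C1_unit_def by (auto intro!: derivative_intros)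
  with I0 I1 show ?thesis
    by (simp add: moment_class_def flip: c_def)
qed

lemma deriv_range_affine: "deriv_range (\<lambda>x. m * x + c) = {m}"
  by (auto simp: deriv_range_def unit_deriv_affine intro!: image_eqI[of _ _ 0])

theorem proposition2:
  fixes \<alpha>0 \<alpha>1 :: real
  shows "optimal_range_interval (moment_class \<alpha>0 \<alpha>1) (12 * \<alpha>1 - 6 * \<alpha>0) (12 * \<alpha>1 - 6 * \<alpha>0)
    \<and> optimal_length (moment_class \<alpha>0 \<alpha>1) 0"
proof -
  define m where "m = 12 * \<alpha>1 - 6 * \<alpha>0"
  \<comment> \<open>This single member bounds both optima from above: every common interval, and
    every interval chosen for \<open>h\<close>, lies in \<open>{m}\<close>.\<close>
  define h where "h = (\<lambda>x. m * x + (\<alpha>0 - m / 2))"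
  have h: "h \<in> moment_class \<alpha>0 \<alpha>1"
    unfolding h_def m_def by (rule affine_in_moment_class)
  have range_h: "deriv_range h = {m}"
    unfolding h_def by (rule deriv_range_affine)
  have m: "{m..m} \<subseteq> deriv_range f" if "f \<in> moment_class \<alpha>0 \<alpha>1" for f
    using moment_slope_in_deriv_range[OF that] by (simp add: m_def)
  have "optimal_range_interval (moment_class \<alpha>0 \<alpha>1) m m"
    using m h range_h unfolding optimal_range_interval_def common_range_interval_def by fastforce
  moreover have "L \<le> 0" if L: "common_range_length (moment_class \<alpha>0 \<alpha>1) L" for L
  proof -
    obtain a b where ab: "b - a = L" "{a..b} \<subseteq> {m}"
      using L h range_h unfolding common_range_length_def by metis
    \<comment> \<open>This gives \<open>a \<le> b\<close>, so both endpoints belong to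
      \<open>{a..b}\<close>; an empty \<open>{a..b}\<close> would lie in \<open>{m}\<close>
      vacuously.\<close>
    moreover have "L \<ge> 0"
      using L by (simp add: common_range_length_def)
    ultimately have "a \<in> {m}" "b \<in> {m}"
      by auto
    with ab show ?thesis by simp
  qed
  moreover have "common_range_length (moment_class \<alpha>0 \<alpha>1) 0"
    using m unfolding common_range_length_def by (metis cancel_comm_monoid_add_class.diff_cancel order_refl)
  ultimately show ?thesis
    unfolding optimal_length_def m_def by blast
qed

end
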